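(* Let $\hat g=C_n^{(1)}$ or $D_n^{(1)}$. Define the $2n\times2n$ matrices $$U=\begin{pmatrix}0&\mathbb I_{n\times n}\\ \mathbb I_{n\times n}&0\end{pmatrix},\qquad W(u)=\begin{pmatrix}0&e^{-u/2}\mathbb I_{n\times n}\\ e^{u/2}\mathbb I_{n\times n}&0\end{pmatrix}.$$ Then the R-matrix obeys $$U_1R_{12}(u)U_1=W_2^t(u)R_{12}(u)W_2^t(u),\qquad U_2R_{12}(u)U_2=W_1(u)R_{12}(u)W_1(u).$$ Furthermore, for every $p\in\{0,1,\dots,n\}$ the K-matrices obey $$W(u)K^R(u,p)W^t(u)=f^R(u,p)K^R(u,n-p),\qquad W^t(u)K^L(u,p)W(u)=f^L(u,p)K^L(u,n-p),$$ where $$f^R(u,p)=\frac{\gamma_0e^u+e^{(2n-4p)\eta}}{\gamma_0+e^{u+(2n-4p)\eta}},\qquad f^L(u,p)=\frac{\gamma_0e^u+e^{(4p+2n\pm4)\eta}}{\gamma_0e^{(4n\pm4)\eta}+e^{u+(4p-2n)\eta}},$$ with $+$ for $C_n^{(1)}$ and $-$ for $D_n^{(1)}$.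
   Context: **R-matrix.** Fix $n\ge1$, $\eta\in\mathbb C$, $d=2n$, $\mathcal V=\mathbb C^{2n}$, $e_{ij}$ the elementary $2n\times2n$ matrices. Let $\kappa=2n+2$ for $C_n^{(1)}$, $\kappa=2n-2$ for $D_n^{(1)}$; $\alpha'=2n+1-\alpha$. For $C_n^{(1)}$: $\epsilon_\alpha=1,\bar\alpha=\alpha-\frac12$ if $\alpha\le n$; $\epsilon_\alpha=-1,\bar\alpha=\alpha+\frac12$ if $\alpha\ge n+1$. For $D_n^{(1)}$: $\epsilon_\alpha=1$; $\bar\alpha=\alpha+\frac12$ if $\alpha\le n$, $\bar\alpha=\alpha-\frac12$ if $\alpha\ge n+1$. Let $$c(u)=2\sinh(\tfrac u2-2\eta)\sinh(\tfrac u2-\kappa\eta),\quad b(u)=2\sinh(\tfrac u2)\sinh(\tfrac u2-\kappa\eta),\quad e(u)=-2e^{-u/2}\sinh(2\eta)\sinh(\tfrac u2-\kappa\eta),\quad \bar e(u)=e^ue(u),$$ and $a_{\alpha\alpha}(u)=2\sinh(\frac u2)\sinh(\frac u2-(\kappa-2)\eta)$, and, with upper signs for $\alpha<\beta$ and lower signs for $\alpha>\beta$, $a_{\alpha\beta}(u)=2\sinh(2\eta)e^{\mp u/2}[\epsilon_\alpha\epsilon_\beta e^{(\pm\kappa+2(\bar\alpha-\bar\beta))\eta}\sinh(\frac u2)-\delta_{\alpha\beta'}\sinh(\frac u2-\kappa\eta)]$. Then, on $\mathcal V\otimes\mathcal V$, $$R_{12}(u)=R(u)=c(u)\sum_{\alpha}e_{\alpha\alpha}\otimes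 e_{\alpha\alpha}+b(u)\sum_{\alpha\neq\beta,\beta'}e_{\alpha\alpha}\otimes e_{\beta\beta}+\Big(e(u)\sum_{\alpha<\beta,\alpha\ne\beta'}+\bar e(u)\sum_{\alpha>\beta,\alpha\ne\beta'}\Big)e_{\alpha\beta}\otimes e_{\beta\alpha}+\sum_{\alpha,\beta}a_{\alpha\beta}(u)e_{\alpha\beta}\otimes e_{\alpha'\beta'}.$$ For a $2n\times 2n$ matrix $X$, $X_1=X\otimes\mathbb I$, $X_2=\mathbb I\otimes X$; $t$ denotes transpose. **K-matrices.** $\rho=-2\kappa\eta$. Fix $\gamma_0\in\{1,-1\}$ (the same for $p$ and $n-p$); $\gamma=\gamma_0e^{(4p+2)\eta+\rho/2}$ for $C_n^{(1)}$, $\gamma=\gamma_0e^{(4p-2)\eta+\rho/2}$ for $D_n^{(1)}$. $K^R(u,p)$ is diagonal with first $p$ entries $e^{-u}$, middle $2n-2p$ entries $\frac{\gamma e^u+1}{\gamma+e^u}$, last $p$ entries $e^u$. $M=\varsigma\sum_\alpha e^{4(\frac{2n+1}2-\bar\alpha)\eta}e_{\alpha\alpha}$ with $\varsigma=-1$ for $C_n^{(1)}$, $\varsigma=1$ for $D_n^{(1)}$; $K^L(u,p)=K^R(-u-\rho,p)M$. Identities in $u$ are understood as identities of meromorphic functions. *)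

theory Defs
  imports
    "HOL-Complex_Analysis.Complex_Analysis"
    "Jordan_Normal_Form.Matrix"
begin

(* Matrices are those of Jordan_Normal_Form, whose entries A $$ (i, j) are
   indexed from 0. The Greek indices alpha, beta of the formulas below run
   over {1..2n}, and elem_mat translates between the two. *)

datatype affine_type = C_affine | D_affine

definition elem_mat :: "nat \<Rightarrow> nat \<Rightarrow> nat \<Rightarrow> complex mat" where
  "elem_mat d \<alpha> \<beta> = Matrix.mat d d (\<lambda>(i, j). if Suc i = \<alpha> \<and> Suc j = \<beta> then 1 else 0)"

(* Matrices of unspecified dimension do not form a monoid type, so sum cannot
   be applied to them directly. *)
definition matsum :: "nat \<Rightarrow> 'i set \<Rightarrow> ('i \<Rightarrow> complex mat) \<Rightarrow> complex mat" where
  "matsum d I A = Matrix.mat d d (\<lambda>ij. \<Sum>x\<in>I. A x $$ ij)"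

(* Tensor product of matrices, with the product basis in lexicographic order. *)
definition kron :: "complex mat \<Rightarrow> complex mat \<Rightarrow> complex mat" where
  "kron A B = Matrix.mat (dim_row A * dim_row B) (dim_col A * dim_col B)
     (\<lambda>(i, j). A $$ (i div dim_row B, j div dim_col B) * B $$ (i mod dim_row B, j mod dim_col B))"

definition on_first :: "nat \<Rightarrow> complex mat \<Rightarrow> complex mat" where
  "on_first n X = kron X (1\<^sub>m (2 * n))"

definition on_second :: "nat \<Rightarrow> complex mat \<Rightarrow> complex mat" where
  "on_second n X = kron (1\<^sub>m (2 * n)) X"

fun kappa :: "affine_type \<Rightarrow> nat \<Rightarrow> complex" where
  "kappa C_affine n = 2 * of_nat n + 2"
| "kappa D_affine n = 2 * of_nat n - 2"

definition conj_idx :: "nat \<Rightarrow> nat \<Rightarrow> nat" where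
  "conj_idx n \<alpha> = 2 * n + 1 - \<alpha>"

fun eps :: "affine_type \<Rightarrow> nat \<Rightarrow> nat \<Rightarrow> complex" where
  "eps C_affine n \<alpha> = (if \<alpha> \<le> n then 1 else -1)"
| "eps D_affine n \<alpha> = 1"

fun bar_idx :: "affine_type \<Rightarrow> nat \<Rightarrow> nat \<Rightarrow> complex" where
  "bar_idx C_affine n \<alpha> = (if \<alpha> \<le> n then of_nat \<alpha> - 1/2 else of_nat \<alpha> + 1/2)"
| "bar_idx D_affine n \<alpha> = (if \<alpha> \<le> n then of_nat \<alpha> + 1/2 else of_nat \<alpha> - 1/2)"

definition c_coeff :: "affine_type \<Rightarrow> nat \<Rightarrow> complex \<Rightarrow> complex \<Rightarrow> complex" where
  "c_coeff g n \<eta> u = 2 * sinh (u/2 - 2 * \<eta>) * sinh (u/2 - kappa g n * \<eta>)"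

definition b_coeff :: "affine_type \<Rightarrow> nat \<Rightarrow> complex \<Rightarrow> complex \<Rightarrow> complex" where
  "b_coeff g n \<eta> u = 2 * sinh (u/2) * sinh (u/2 - kappa g n * \<eta>)"

definition e_coeff :: "affine_type \<Rightarrow> nat \<Rightarrow> complex \<Rightarrow> complex \<Rightarrow> complex" where
  "e_coeff g n \<eta> u = - 2 * exp (- u/2) * sinh (2 * \<eta>) * sinh (u/2 - kappa g n * \<eta>)"

definition ebar_coeff :: "affine_type \<Rightarrow> nat \<Rightarrow> complex \<Rightarrow> complex \<Rightarrow> complex" where
  "ebar_coeff g n \<eta> u = exp u * e_coeff g n \<eta> u"

definition a_coeff ::
  "affine_type \<Rightarrow> nat \<Rightarrow> complex \<Rightarrow> complex \<Rightarrow> nat \<Rightarrow> nat \<Rightarrow> complex" where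
  "a_coeff g n \<eta> u \<alpha> \<beta> =
     (if \<alpha> = \<beta> then 2 * sinh (u/2) * sinh (u/2 - (kappa g n - 2) * \<eta>)
      else if \<alpha> < \<beta> then
        2 * sinh (2 * \<eta>) * exp (- u/2) *
          (eps g n \<alpha> * eps g n \<beta> *
             exp ((kappa g n + 2 * (bar_idx g n \<alpha> - bar_idx g n \<beta>)) * \<eta>) * sinh (u/2)
           - (if \<alpha> = conj_idx n \<beta> then 1 else 0) * sinh (u/2 - kappa g n * \<eta>))
      else
        2 * sinh (2 * \<eta>) * exp (u/2) *
          (eps g n \<alpha> * eps g n \<beta> *
             exp ((- kappa g n + 2 * (bar_idx g n \<alpha> - bar_idx g n \<beta>)) * \<eta>) * sinh (u/2)
           - (if \<alpha> = conj_idx n \<beta> then 1 else 0) * sinh (u/2 - kappa g n * \<eta>)))"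

definition R_mat :: "affine_type \<Rightarrow> nat \<Rightarrow> complex \<Rightarrow> complex \<Rightarrow> complex mat" where
  "R_mat g n \<eta> u =
    (let d = 2 * n; N = {1..d}; E = elem_mat d in
       c_coeff g n \<eta> u \<cdot>\<^sub>m matsum (d * d) N (\<lambda>\<alpha>. kron (E \<alpha> \<alpha>) (E \<alpha> \<alpha>))
     + b_coeff g n \<eta> u \<cdot>\<^sub>m
         matsum (d * d) {(\<alpha>, \<beta>) \<in> N \<times> N. \<alpha> \<noteq> \<beta> \<and> \<alpha> \<noteq> conj_idx n \<beta>} (\<lambda>(\<alpha>, \<beta>). kron (E \<alpha> \<alpha>) (E \<beta> \<beta>))
     + e_coeff g n \<eta> u \<cdot>\<^sub>m
         matsum (d * d) {(\<alpha>, \<beta>) \<in> N \<times> N. \<alpha> < \<beta> \<and> \<alpha> \<noteq> conj_idx n \<beta>} (\<lambda>(\<alpha>, \<beta>). kron (E \<alpha> \<beta>) (E \<beta> \<alpha>))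
     + ebar_coeff g n \<eta> u \<cdot>\<^sub>m
         matsum (d * d) {(\<alpha>, \<beta>) \<in> N \<times> N. \<alpha> > \<beta> \<and> \<alpha> \<noteq> conj_idx n \<beta>} (\<lambda>(\<alpha>, \<beta>). kron (E \<alpha> \<beta>) (E \<beta> \<alpha>))
     + matsum (d * d) (N \<times> N)
         (\<lambda>(\<alpha>, \<beta>). a_coeff g n \<eta> u \<alpha> \<beta> \<cdot>\<^sub>m kron (E \<alpha> \<beta>) (E (conj_idx n \<alpha>) (conj_idx n \<beta>))))"

definition rho :: "affine_type \<Rightarrow> nat \<Rightarrow> complex \<Rightarrow> complex" where
  "rho g n \<eta> = - 2 * kappa g n * \<eta>"

(* The sign that is + for C and - for D, both in the exponent 4p +- 2 of gamma
   and in the terms +- 4 of f^L. *)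
fun type_sign :: "affine_type \<Rightarrow> complex" where
  "type_sign C_affine = 1"
| "type_sign D_affine = -1"

definition gam :: "affine_type \<Rightarrow> nat \<Rightarrow> complex \<Rightarrow> complex \<Rightarrow> nat \<Rightarrow> complex" where
  "gam g n \<eta> \<gamma>0 p = \<gamma>0 * exp ((4 * of_nat p + 2 * type_sign g) * \<eta> + rho g n \<eta> / 2)"

definition KR_mat ::
  "affine_type \<Rightarrow> nat \<Rightarrow> complex \<Rightarrow> complex \<Rightarrow> complex \<Rightarrow> nat \<Rightarrow> complex mat" where
  "KR_mat g n \<eta> \<gamma>0 u p = Matrix.mat (2 * n) (2 * n) (\<lambda>(i, j).
     if i \<noteq> j then 0
     else if i < p then exp (- u)
     else if i < 2 * n - p then
       (gam g n \<eta> \<gamma>0 p * exp u + 1) / (gam g n \<eta> \<gamma>0 p + exp u)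
     else exp u)"

fun varsig :: "affine_type \<Rightarrow> complex" where
  "varsig C_affine = -1"
| "varsig D_affine = 1"

definition M_mat :: "affine_type \<Rightarrow> nat \<Rightarrow> complex \<Rightarrow> complex mat" where
  "M_mat g n \<eta> = varsig g \<cdot>\<^sub>m matsum (2 * n) {1..2 * n}
     (\<lambda>\<alpha>. exp (4 * ((2 * of_nat n + 1) / 2 - bar_idx g n \<alpha>) * \<eta>) \<cdot>\<^sub>m elem_mat (2 * n) \<alpha> \<alpha>)"

definition KL_mat ::
  "affine_type \<Rightarrow> nat \<Rightarrow> complex \<Rightarrow> complex \<Rightarrow> complex \<Rightarrow> nat \<Rightarrow> complex mat" where
  "KL_mat g n \<eta> \<gamma>0 u p = KR_mat g n \<eta> \<gamma>0 (- u - rho g n \<eta>) p * M_mat g n \<eta>"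

definition U_mat :: "nat \<Rightarrow> complex mat" where
  "U_mat n = four_block_mat (0\<^sub>m n n) (1\<^sub>m n) (1\<^sub>m n) (0\<^sub>m n n)"

definition W_mat :: "nat \<Rightarrow> complex \<Rightarrow> complex mat" where
  "W_mat n u = four_block_mat (0\<^sub>m n n) (exp (- u/2) \<cdot>\<^sub>m 1\<^sub>m n) (exp (u/2) \<cdot>\<^sub>m 1\<^sub>m n) (0\<^sub>m n n)"

definition fR :: "nat \<Rightarrow> complex \<Rightarrow> complex \<Rightarrow> complex \<Rightarrow> nat \<Rightarrow> complex" where
  "fR n \<eta> \<gamma>0 u p =
     (\<gamma>0 * exp u + exp ((2 * of_nat n - 4 * of_nat p) * \<eta>)) /
     (\<gamma>0 + exp (u + (2 * of_nat n - 4 * of_nat p) * \<eta>))"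

definition fL :: "affine_type \<Rightarrow> nat \<Rightarrow> complex \<Rightarrow> complex \<Rightarrow> complex \<Rightarrow> nat \<Rightarrow> complex" where
  "fL g n \<eta> \<gamma>0 u p =
     (\<gamma>0 * exp u + exp ((4 * of_nat p + 2 * of_nat n + 4 * type_sign g) * \<eta>)) /
     (\<gamma>0 * exp ((4 * of_nat n + 4 * type_sign g) * \<eta>)
        + exp (u + (4 * of_nat p - 2 * of_nat n) * \<eta>))"

(* Equality of two d x d matrices of meromorphic functions on the complex
   plane. Meromorphic functions are equal when they agree off a discrete
   closed set, so the library's convention x / 0 = 0 at poles is irrelevant. *)
definition mero_mat_eq ::
  "nat \<Rightarrow> (complex \<Rightarrow> complex mat) \<Rightarrow> (complex \<Rightarrow> complex mat) \<Rightarrow> bool" where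
  "mero_mat_eq d F G \<longleftrightarrow>
     (\<forall>u. F u \<in> carrier_mat d d \<and> G u \<in> carrier_mat d d) \<and>
     (\<forall>i<d. \<forall>j<d.
        (\<lambda>u. F u $$ (i, j)) meromorphic_on UNIV \<and>
        (\<lambda>u. G u $$ (i, j)) meromorphic_on UNIV \<and>
        (\<forall>\<^sub>F u in cosparse UNIV. F u $$ (i, j) = G u $$ (i, j)))"

end

theory Submission
  imports Defs
begin

text \<open>
  The matrices $U = W(0)$, $W(u)$ and $W^t(u) = W(-u)$ are weighted permutation matrices for the
  half shift $i \mapsto i \pm n$. Conjugating $R$ or $K$ by them therefore relabels entries and
  multiplies them by weights, and each identity becomes an identity between scalar coefficients.
  The half shift commutes with $\alpha \mapsto \alpha'$ and moves $\bar\alpha$ by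
  $\pm\kappa/2$, which is exactly what turns $a_{\alpha\beta}$ for $\alpha<\beta$ into
  $a_{\alpha\beta}$ for $\alpha>\beta$. The weights $e^{\mp u/2}$ are a charge that $R$
  conserves, so they can be attached to either tensor factor.

  For the K-matrices one has $\gamma = \gamma_0 e^{(4p-2n)\eta}$ in both cases. The half shift
  multiplies the entries of $M$ by $e^{\pm\rho}$, and $f^L(u,p) = f^R(-u-\rho,p)$, so
  the identity for $K^L$ at $u$ is the one for $K^R$ at $-u-\rho$.
\<close>

section \<open>Weighted permutation matrices\<close>

definition mono_mat :: "nat \<Rightarrow> (nat \<Rightarrow> nat) \<Rightarrow> (nat \<Rightarrow> complex) \<Rightarrow> complex mat" where
  "mono_mat d s w = Matrix.mat d d (\<lambda>(i, j). if j = s i then w i else 0)"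

lemma mono_mat_carrier [simp]: "mono_mat d s w \<in> carrier_mat d d"
  by (simp add: mono_mat_def)

text \<open>Since \<open>s\<close> is an involution, the only nonzero entry in column
  \<open>j\<close> of the right factor sits in row \<open>s j\<close>. This is why the right weight
  is \<open>w (s j)\<close> and not \<open>w j\<close>.\<close>

lemma mono_mat_mult_index:
  assumes X: "X \<in> carrier_mat d d"
    and s: "\<And>i. i < d \<Longrightarrow> s i < d" "\<And>i. i < d \<Longrightarrow> s (s i) = i"
    and ij: "i < d" "j < d"
  shows "(mono_mat d s v * X * mono_mat d s w) $$ (i, j) = v i * X $$ (s i, s j) * w (s j)"
proof -
  have left: "(mono_mat d s v * X) $$ (i, k) = v i * X $$ (s i, k)" if "k < d" for k
    using X ij s that
    by (simp add: mono_mat_def scalar_prod_def if_distrib if_distribR sum.delta cong: if_cong)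
  have eq: "j = s k \<longleftrightarrow> k = s j" if "k < d" for k
    using s ij that by metis
  have "(mono_mat d s v * X * mono_mat d s w) $$ (i, j)
      = (\<Sum>k\<in>{0..<d}. (mono_mat d s v * X) $$ (i, k) * mono_mat d s w $$ (k, j))"
    using X ij
    by (subst index_mult_mat(1)) (auto simp: scalar_prod_def mono_mat_def intro!: sum.cong)
  also have "\<dots> = (\<Sum>k\<in>{0..<d}. if k = s j then v i * X $$ (s i, k) * w k else 0)"
  proof (rule sum.cong)
    fix k assume "k \<in> {0..<d}"
    then have k: "k < d" by simp
    then have "mono_mat d s w $$ (k, j) = (if k = s j then w k else 0)"
      unfolding mono_mat_def using ij eq[OF k] by simp
    then show "(mono_mat d s v * X) $$ (i, k) * mono_mat d s w $$ (k, j)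
        = (if k = s j then v i * X $$ (s i, k) * w k else 0)"
      by (simp only: left[OF k] mult_zero_right split: if_split) simp
  qed simp
  also have "\<dots> = v i * X $$ (s i, s j) * w (s j)"
    using ij s by (simp add: sum.delta)
  finally show ?thesis .
qed

section \<open>The half shift and the matrices U and W\<close>

definition swap_half :: "nat \<Rightarrow> nat \<Rightarrow> nat" where
  "swap_half n i = (if i < n then i + n else i - n)"

definition half_weight :: "nat \<Rightarrow> complex \<Rightarrow> nat \<Rightarrow> complex" where
  "half_weight n u i = (if i < n then exp (- u/2) else exp (u/2))"

lemma swap_half_less [simp]: "i < 2 * n \<Longrightarrow> swap_half n i < 2 * n"
  by (auto simp: swap_half_def)

lemma swap_half_swap_half [simp]: "i < 2 * n \<Longrightarrow> swap_half n (swap_half n i) = i"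
  by (auto simp: swap_half_def)

lemma swap_half_eq_iff:
  "i < 2 * n \<Longrightarrow> j < 2 * n \<Longrightarrow> swap_half n i = j \<longleftrightarrow> i = swap_half n j"
  by (auto simp: swap_half_def)

lemma swap_half_inj:
  "i < 2 * n \<Longrightarrow> j < 2 * n \<Longrightarrow> swap_half n i = swap_half n j \<longleftrightarrow> i = j"
  by (auto simp: swap_half_def)

lemma W_mat_eq: "W_mat n u = mono_mat (2 * n) (swap_half n) (half_weight n u)"
  by (rule eq_matI) (auto simp: W_mat_def mono_mat_def swap_half_def half_weight_def)

lemma W_mat_transpose: "transpose_mat (W_mat n u) = W_mat n (- u)"
  by (rule eq_matI) (auto simp: W_mat_def)

lemma U_mat_eq: "U_mat n = W_mat n 0"
  by (rule eq_matI) (auto simp: U_mat_def W_mat_def)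

section \<open>Tensor factors as base-d digits of an index\<close>

lemma eq_mult_add_iff_div_mod:
  "y = a * d + b \<longleftrightarrow> y div d = a \<and> y mod d = b" if "b < d" for a b d y :: nat
proof
  assume "y = a * d + b"
  then show "y div d = a \<and> y mod d = b" using that by simp
next
  assume "y div d = a \<and> y mod d = b"
  then show "y = a * d + b" using div_mult_mod_eq[of y d] by simp
qed

lemma block_index_div_mod:
  fixes a b d :: nat
  assumes "b < d"
  shows "(a * d + b) div d = a" "(a * d + b) mod d = b"
  using eq_mult_add_iff_div_mod[OF assms, of "a * d + b" a] by blast+

lemma block_index_less:
  fixes a b d :: nat
  assumes "a < d" "b < d"
  shows "a * d + b < d * d"
proof -
  have "a * d + b < Suc a * d" using assms by simp
  also have "\<dots> \<le> d * d" using assms by (intro mult_right_mono) auto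
  finally show ?thesis .
qed

lemma div_mod_less:
  fixes x d :: nat
  assumes "x < d * d"
  shows "x div d < d" "x mod d < d"
  using assms by (auto simp: less_mult_imp_div_less intro!: mod_less_divisor Nat.gr0I)

text \<open>Tensoring with the identity keeps the weighted permutation form: the permutation and the
  weight act on the leading base-\<open>d\<close> digit only. Conjugation in one tensor factor thus
  falls under \<open>mono_mat_mult_index\<close>.\<close>

lemma kron_mono_mat_one:
  assumes s: "\<And>i. i < d \<Longrightarrow> s i < d"
  shows "kron (mono_mat d s w) (1\<^sub>m d) =
    mono_mat (d * d) (\<lambda>x. s (x div d) * d + x mod d) (\<lambda>x. w (x div d))" (is "_ = ?R")
proof (rule eq_matI)
  fix x y assume "x < dim_row ?R" "y < dim_col ?R"
  then have xy: "x < d * d" "y < d * d" by (simp_all add: mono_mat_def)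
  then have d: "d > 0" by (auto intro: Nat.gr0I)
  have lt: "x div d < d" "y div d < d" "x mod d < d" "y mod d < d"
    using xy d by (auto simp: less_mult_imp_div_less)
  have iff: "y = s (x div d) * d + x mod d \<longleftrightarrow> y div d = s (x div d) \<and> y mod d = x mod d"
    by (rule eq_mult_add_iff_div_mod[OF lt(3)])
  show "kron (mono_mat d s w) (1\<^sub>m d) $$ (x, y) = ?R $$ (x, y)"
    using xy lt by (simp add: kron_def mono_mat_def iff eq_commute[of "x mod d" "y mod d"])
qed (simp_all add: kron_def mono_mat_def)

lemma kron_one_mono_mat:
  assumes s: "\<And>i. i < d \<Longrightarrow> s i < d"
  shows "kron (1\<^sub>m d) (mono_mat d s w) =
    mono_mat (d * d) (\<lambda>x. x div d * d + s (x mod d)) (\<lambda>x. w (x mod d))" (is "_ = ?R")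
proof (rule eq_matI)
  fix x y assume "x < dim_row ?R" "y < dim_col ?R"
  then have xy: "x < d * d" "y < d * d" by (simp_all add: mono_mat_def)
  then have d: "d > 0" by (auto intro: Nat.gr0I)
  have lt: "x div d < d" "y div d < d" "x mod d < d" "y mod d < d"
    using xy d by (auto simp: less_mult_imp_div_less)
  have iff: "y = x div d * d + s (x mod d) \<longleftrightarrow> y div d = x div d \<and> y mod d = s (x mod d)"
    by (rule eq_mult_add_iff_div_mod[OF s[OF lt(3)]])
  show "kron (1\<^sub>m d) (mono_mat d s w) $$ (x, y) = ?R $$ (x, y)"
    using xy lt by (simp add: kron_def mono_mat_def iff eq_commute[of "x div d" "y div d"])
qed (simp_all add: kron_def mono_mat_def)

section \<open>The R-matrix\<close>

text \<open>Indices start at 0, so that $\alpha = \beta'$ reads \<open>Suc (i + j) = 2 * n\<close>.\<close>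
definition R_entry ::
  "affine_type \<Rightarrow> nat \<Rightarrow> complex \<Rightarrow> complex \<Rightarrow> nat \<Rightarrow> nat \<Rightarrow> nat \<Rightarrow> nat \<Rightarrow> complex" where
  "R_entry g n \<eta> u i k j l =
     (if i = j \<and> k = l \<and> i = k then c_coeff g n \<eta> u else 0)
   + (if i = j \<and> k = l \<and> i \<noteq> k \<and> Suc (i + k) \<noteq> 2 * n then b_coeff g n \<eta> u else 0)
   + (if i = l \<and> k = j \<and> i < j \<and> Suc (i + j) \<noteq> 2 * n then e_coeff g n \<eta> u else 0)
   + (if i = l \<and> k = j \<and> i > j \<and> Suc (i + j) \<noteq> 2 * n then ebar_coeff g n \<eta> u else 0)
   + (if Suc (i + k) = 2 * n \<and> Suc (j + l) = 2 * n then a_coeff g n \<eta> u (Suc i) (Suc j) else 0)"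

lemma kron_elem_mat_index:
  assumes "x < d * d" "y < d * d"
  shows "kron (elem_mat d \<alpha> \<beta>) (elem_mat d \<gamma> \<delta>) $$ (x, y) =
    (if \<alpha> = Suc (x div d) \<and> \<beta> = Suc (y div d) \<and> \<gamma> = Suc (x mod d) \<and> \<delta> = Suc (y mod d) then 1 else 0)"
proof -
  have "d > 0" using assms by (auto intro: Nat.gr0I)
  moreover have "x div d < d" "y div d < d" using assms by (auto simp: less_mult_imp_div_less)
  ultimately show ?thesis using assms by (auto simp: kron_def elem_mat_def)
qed

text \<open>The predicate \<open>P\<close> makes room for conditions that do not fix the summation
  variables, such as equality of row and column digits.\<close>

lemma sum_pair_delta:
  assumes "finite I"
  shows "(\<Sum>(\<alpha>, \<beta>)\<in>I. if \<alpha> = a \<and> \<beta> = b \<and> P \<alpha> \<beta> then f \<alpha> \<beta> else (0::complex))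
       = (if (a, b) \<in> I \<and> P a b then f a b else 0)"
proof -
  have "(\<Sum>(\<alpha>, \<beta>)\<in>I. if \<alpha> = a \<and> \<beta> = b \<and> P \<alpha> \<beta> then f \<alpha> \<beta> else (0::complex))
      = (\<Sum>z\<in>I. if z = (a, b) then (if P a b then f a b else 0) else 0)"
    by (rule sum.cong) (auto split: if_splits)
  also have "\<dots> = (if (a, b) \<in> I \<and> P a b then f a b else 0)"
    using assms by (auto simp: sum.delta)
  finally show ?thesis .
qed

lemma matsum_carrier [simp]: "matsum d I A \<in> carrier_mat d d"
  "dim_row (matsum d I A) = d" "dim_col (matsum d I A) = d"
  by (simp_all add: matsum_def)

lemma R_mat_carrier [simp]: "R_mat g n \<eta> u \<in> carrier_mat (2 * n * (2 * n)) (2 * n * (2 * n))"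
  by (simp add: R_mat_def Let_def)

text \<open>A product of elementary matrices has its single 1 where the row digits are the two row
  labels and the column digits the two column labels. Each sum defining R therefore contributes at
  most one term to a given entry.\<close>

lemma R_mat_index:
  assumes "x < 2 * n * (2 * n)" "y < 2 * n * (2 * n)"
  shows "R_mat g n \<eta> u $$ (x, y) =
    R_entry g n \<eta> u (x div (2 * n)) (x mod (2 * n)) (y div (2 * n)) (y mod (2 * n))"
proof -
  define d where "d = 2 * n"
  have xy: "x < d * d" "y < d * d" using assms by (auto simp: d_def)
  then have d: "d > 0" by (auto intro: Nat.gr0I)
  \<comment> \<open>The row is the pair (i, k) and the column the pair (j, l): i and j belong to the
    first tensor factor, k and l to the second.\<close>
  define i k j l where "i = x div d" and "k = x mod d" and "j = y div d" and "l = y mod d"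
  have lt: "i < d" "k < d" "j < d" "l < d"
    using xy d by (auto simp: i_def j_def k_def l_def less_mult_imp_div_less)
  define E where "E = elem_mat d"
  note kr = kron_elem_mat_index[OF xy, folded i_def j_def k_def l_def E_def]
  have fin: "finite {(\<alpha>, \<beta>) \<in> {1..d} \<times> {1..d}. P \<alpha> \<beta>}" for P
    by (rule finite_subset[of _ "{1..d} \<times> {1..d}"]) auto
  have ms: "matsum (d * d) I A $$ (x, y) = (\<Sum>z\<in>I. A z $$ (x, y))" for I :: "'z set" and A
    using xy by (simp add: matsum_def)
  have c: "matsum (d * d) {1..d} (\<lambda>\<alpha>. kron (E \<alpha> \<alpha>) (E \<alpha> \<alpha>)) $$ (x, y)
      = (if i = j \<and> k = l \<and> i = k then 1 else 0)"
  proof -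
    have "(\<Sum>\<alpha>\<in>{1..d}. kron (E \<alpha> \<alpha>) (E \<alpha> \<alpha>) $$ (x, y))
        = (\<Sum>\<alpha>\<in>{1..d}. if \<alpha> = Suc i then (if i = j \<and> k = l \<and> i = k then 1 else 0) else 0)"
      by (rule sum.cong) (auto simp: kr)
    then show ?thesis using lt by (simp add: ms sum.delta)
  qed
  have b: "matsum (d * d) {(\<alpha>, \<beta>) \<in> {1..d} \<times> {1..d}. P \<alpha> \<beta>} (\<lambda>(\<alpha>, \<beta>). kron (E \<alpha> \<alpha>) (E \<beta> \<beta>)) $$ (x, y)
      = (if i = j \<and> k = l \<and> P (Suc i) (Suc k) then 1 else 0)" for P
  proof -
    have "matsum (d * d) {(\<alpha>, \<beta>) \<in> {1..d} \<times> {1..d}. P \<alpha> \<beta>} (\<lambda>(\<alpha>, \<beta>). kron (E \<alpha> \<alpha>) (E \<beta> \<beta>)) $$ (x, y)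
        = (\<Sum>(\<alpha>, \<beta>)\<in>{(\<alpha>, \<beta>) \<in> {1..d} \<times> {1..d}. P \<alpha> \<beta>}. if \<alpha> = Suc i \<and> \<beta> = Suc k \<and> (i = j \<and> k = l) then 1 else 0)"
      unfolding ms by (rule sum.cong) (auto simp: kr)
    also have "\<dots> = (if i = j \<and> k = l \<and> P (Suc i) (Suc k) then 1 else 0)"
      unfolding sum_pair_delta[OF fin, where P = "\<lambda>_ _. i = j \<and> k = l"] using lt by auto
    finally show ?thesis .
  qed
  \<comment> \<open>Leaving \<open>P\<close> free lets one computation serve both exchange sums,
    over \<alpha> < \<beta> and over \<alpha> > \<beta>.\<close>
  have e: "matsum (d * d) {(\<alpha>, \<beta>) \<in> {1..d} \<times> {1..d}. P \<alpha> \<beta>} (\<lambda>(\<alpha>, \<beta>). kron (E \<alpha> \<beta>) (E \<beta> \<alpha>)) $$ (x, y)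
      = (if i = l \<and> k = j \<and> P (Suc i) (Suc j) then 1 else 0)" for P
  proof -
    have "matsum (d * d) {(\<alpha>, \<beta>) \<in> {1..d} \<times> {1..d}. P \<alpha> \<beta>} (\<lambda>(\<alpha>, \<beta>). kron (E \<alpha> \<beta>) (E \<beta> \<alpha>)) $$ (x, y)
        = (\<Sum>(\<alpha>, \<beta>)\<in>{(\<alpha>, \<beta>) \<in> {1..d} \<times> {1..d}. P \<alpha> \<beta>}. if \<alpha> = Suc i \<and> \<beta> = Suc j \<and> (i = l \<and> k = j) then 1 else 0)"
      unfolding ms by (rule sum.cong) (auto simp: kr)
    also have "\<dots> = (if i = l \<and> k = j \<and> P (Suc i) (Suc j) then 1 else 0)"
      unfolding sum_pair_delta[OF fin, where P = "\<lambda>_ _. i = l \<and> k = j"] using lt by auto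
    finally show ?thesis .
  qed
  have conj: "Suc p = conj_idx n (Suc q) \<longleftrightarrow> Suc (p + q) = d" if "q < d" for p q
    using that by (auto simp: conj_idx_def d_def)
  have conj': "conj_idx n (Suc q) = Suc p \<longleftrightarrow> Suc (q + p) = d" if "q < d" for p q
    using that by (auto simp: conj_idx_def d_def)
  have a: "matsum (d * d) ({1..d} \<times> {1..d}) (\<lambda>(\<alpha>, \<beta>). f \<alpha> \<beta> \<cdot>\<^sub>m kron (E \<alpha> \<beta>) (E (conj_idx n \<alpha>) (conj_idx n \<beta>))) $$ (x, y)
      = (if Suc (i + k) = d \<and> Suc (j + l) = d then f (Suc i) (Suc j) else 0)" for f
  proof -
    have sm: "(f \<alpha> \<beta> \<cdot>\<^sub>m kron (E \<alpha> \<beta>) (E \<gamma> \<delta>)) $$ (x, y) = f \<alpha> \<beta> * kron (E \<alpha> \<beta>) (E \<gamma> \<delta>) $$ (x, y)" for \<alpha> \<beta> \<gamma> \<delta>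
      using xy by (subst index_smult_mat) (auto simp: kron_def elem_mat_def E_def)
    have "matsum (d * d) ({1..d} \<times> {1..d}) (\<lambda>(\<alpha>, \<beta>). f \<alpha> \<beta> \<cdot>\<^sub>m kron (E \<alpha> \<beta>) (E (conj_idx n \<alpha>) (conj_idx n \<beta>))) $$ (x, y)
        = (\<Sum>(\<alpha>, \<beta>)\<in>{1..d} \<times> {1..d}. if \<alpha> = Suc i \<and> \<beta> = Suc j \<and> (Suc (i + k) = d \<and> Suc (j + l) = d) then f \<alpha> \<beta> else 0)"
      unfolding ms by (rule sum.cong) (use lt in \<open>auto simp: sm kr conj'\<close>)
    also have "\<dots> = (if Suc (i + k) = d \<and> Suc (j + l) = d then f (Suc i) (Suc j) else 0)"
      by (subst sum_pair_delta[where P = "\<lambda>_ _. Suc (i + k) = d \<and> Suc (j + l) = d"]) (use lt in simp_all)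
    finally show ?thesis .
  qed
  have add: "(A + B) $$ (x, y) = A $$ (x, y) + B $$ (x, y)"
    if "B \<in> carrier_mat (d * d) (d * d)" for A B :: "complex mat"
    using that xy by simp
  have smult: "(s \<cdot>\<^sub>m B) $$ (x, y) = s * B $$ (x, y)"
    if "B \<in> carrier_mat (d * d) (d * d)" for s and B :: "complex mat"
    using that xy by simp
  have *: "R_mat g n \<eta> u $$ (x, y) = R_entry g n \<eta> u i k j l"
    unfolding R_mat_def Let_def d_def[symmetric] E_def[symmetric]
    by (simp only: add smult smult_carrier_mat matsum_carrier b c e a R_entry_def conj lt
        d_def[symmetric] nat.inject Suc_less_eq if_distrib[of "\<lambda>z. _ * z"] mult_1_right mult_zero_right)
  then show ?thesis by (simp only: d_def i_def j_def k_def l_def)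
qed


section \<open>Coefficients of R under the half shift\<close>

lemma half_weight_swap_half:
  "i < 2 * n \<Longrightarrow> half_weight n u (swap_half n i) = half_weight n (- u) i"
  by (auto simp: half_weight_def swap_half_def)

lemma half_weight_uminus_mult [simp]: "half_weight n (- u) i * half_weight n u i = 1"
  by (simp add: half_weight_def exp_minus)

lemma Suc_swap_half_add_eq_iff:
  "i < 2 * n \<Longrightarrow> j < 2 * n \<Longrightarrow> Suc (swap_half n i + j) = 2 * n \<longleftrightarrow> Suc (i + swap_half n j) = 2 * n"
  by (auto simp: swap_half_def)

lemma Suc_eq_conj_idx_iff:
  "j < 2 * n \<Longrightarrow> Suc i = conj_idx n (Suc j) \<longleftrightarrow> Suc (i + j) = 2 * n"
  by (auto simp: conj_idx_def)

text \<open>The shift changes the index by n, and crossing the middle changes the half-integer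
  correction by 1, outwards for C and inwards for D. The total is n + 1 or n - 1, which is
  \<kappa>/2 in both cases.\<close>

lemma bar_idx_swap_half:
  "i < 2 * n \<Longrightarrow> bar_idx g n (Suc (swap_half n i)) =
     bar_idx g n (Suc i) + (if i < n then kappa g n / 2 else - kappa g n / 2)"
  by (cases g) (auto simp: swap_half_def of_nat_diff field_simps)

lemma eps_swap_half:
  "i < 2 * n \<Longrightarrow> j < 2 * n \<Longrightarrow>
     eps g n (Suc (swap_half n i)) * eps g n (Suc (swap_half n j)) = eps g n (Suc i) * eps g n (Suc j)"
  by (cases g) (auto simp: swap_half_def)

text \<open>The shift preserves the order of \<open>i\<close> and \<open>j\<close> within one half
  and reverses it across halves. In the reversed case the difference of barred indices moves by
  \<kappa> up or down, which offsets the sign change of \<kappa> in the exponent. Only the prefactor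
  exp(-u/2) or exp(u/2) changes, and the weights supply the missing exp(u) or exp(-u).\<close>

lemma a_coeff_swap_half:
  assumes "i < 2 * n" "j < 2 * n"
  shows "a_coeff g n \<eta> u (Suc (swap_half n i)) (Suc (swap_half n j)) =
    half_weight n (- u) i * half_weight n u j * a_coeff g n \<eta> u (Suc i) (Suc j)"
proof -
  have inj: "swap_half n i = swap_half n j \<longleftrightarrow> i = j"
    using assms by (rule swap_half_inj)
  have conj: "Suc (swap_half n i) = conj_idx n (Suc (swap_half n j)) \<longleftrightarrow> Suc i = conj_idx n (Suc j)"
    using assms by (simp add: Suc_eq_conj_idx_iff Suc_swap_half_add_eq_iff)
  have same: ?thesis if "i < n \<longleftrightarrow> j < n"
  proof -
    have lt: "swap_half n i < swap_half n j \<longleftrightarrow> i < j"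
      using that assms by (auto simp: swap_half_def)
    have bar: "bar_idx g n (Suc (swap_half n i)) - bar_idx g n (Suc (swap_half n j))
        = bar_idx g n (Suc i) - bar_idx g n (Suc j)"
      using assms that by (simp add: bar_idx_swap_half)
    have w: "half_weight n (- u) i * half_weight n u j = 1"
      using that by (auto simp: half_weight_def exp_minus)
    show ?thesis
      unfolding a_coeff_def nat.inject Suc_less_eq lt inj conj bar eps_swap_half[OF assms] w by simp
  qed
  have up: ?thesis if "i < n" "\<not> j < n"
  proof -
    have lt: "\<not> swap_half n i < swap_half n j" "i < j" "i \<noteq> j"
      using that assms by (auto simp: swap_half_def)
    have bar: "- kappa g n + 2 * (bar_idx g n (Suc (swap_half n i)) - bar_idx g n (Suc (swap_half n j)))
        = kappa g n + 2 * (bar_idx g n (Suc i) - bar_idx g n (Suc j))"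
      using assms that by (simp add: bar_idx_swap_half field_simps)
    \<comment> \<open>With \<open>c\<close> and \<open>X\<close> arbitrary, the weights can be
      absorbed into the exponential without opening the bracket that holds the rest of the
      coefficient.\<close>
    have w: "half_weight n (- u) i * half_weight n u j * (c * exp (- u/2) * X) = c * exp (u/2) * X" for c X
      using that by (simp add: half_weight_def exp_minus)
    show ?thesis
      unfolding a_coeff_def nat.inject Suc_less_eq inj conj bar eps_swap_half[OF assms]
      by (simp only: lt if_True if_False w)
  qed
  have down: ?thesis if "\<not> i < n" "j < n"
  proof -
    have lt: "swap_half n i < swap_half n j" "\<not> i < j" "i \<noteq> j"
      using that assms by (auto simp: swap_half_def)
    have bar: "kappa g n + 2 * (bar_idx g n (Suc (swap_half n i)) - bar_idx g n (Suc (swap_half n j)))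
        = - kappa g n + 2 * (bar_idx g n (Suc i) - bar_idx g n (Suc j))"
      using assms that by (simp add: bar_idx_swap_half field_simps)
    have w: "half_weight n (- u) i * half_weight n u j * (c * exp (u/2) * X) = c * exp (- u/2) * X" for c X
      using that by (simp add: half_weight_def exp_minus)
    show ?thesis
      unfolding a_coeff_def nat.inject Suc_less_eq inj conj bar eps_swap_half[OF assms]
      by (simp only: lt if_True if_False w)
  qed
  show ?thesis using same up down by blast
qed

text \<open>Across halves the shift interchanges the two exchange coefficients. Their ratio is
  exp(u), exactly the product of the weights.\<close>

lemma exchange_coeff_swap_half:
  assumes "i < 2 * n" "j < 2 * n" "i \<noteq> j"
  shows "(if swap_half n i < swap_half n j then e_coeff g n \<eta> u else ebar_coeff g n \<eta> u) =
    half_weight n (- u) i * half_weight n u j * (if i < j then e_coeff g n \<eta> u else ebar_coeff g n \<eta> u)"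
proof -
  have "exp (u/2) * exp (u/2) = exp u" by (simp flip: exp_add)
  then have "exp (u/2) * (exp (u/2) * X) = exp u * X" for X by (simp flip: mult.assoc)
  then show ?thesis
    using assms by (auto simp: swap_half_def half_weight_def ebar_coeff_def exp_minus field_simps)
qed

text \<open>The two exchange terms become one because the half shift may turn either into the other;
  only the merged term transforms by a single factor.\<close>

lemma R_entry_alt:
  "R_entry g n \<eta> u i k j l =
     (if i = j \<and> k = l \<and> i = k then c_coeff g n \<eta> u else 0)
   + (if i = j \<and> k = l \<and> i \<noteq> k \<and> Suc (i + k) \<noteq> 2 * n then b_coeff g n \<eta> u else 0)
   + (if i = l \<and> k = j \<and> i \<noteq> j \<and> Suc (i + j) \<noteq> 2 * n
      then (if i < j then e_coeff g n \<eta> u else ebar_coeff g n \<eta> u) else 0)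
   + (if Suc (i + k) = 2 * n \<and> Suc (j + l) = 2 * n then a_coeff g n \<eta> u (Suc i) (Suc j) else 0)"
  by (simp add: R_entry_def)

text \<open>This is the entrywise form of the identity with U in the second factor and W in the
  first. In the diagonal terms i = j, so the weights cancel; the exchange and \<open>a_coeff\<close>
  terms carry the weights computed above.\<close>

lemma R_entry_swap_half:
  assumes lt: "i < 2 * n" "k < 2 * n" "j < 2 * n" "l < 2 * n"
  shows "R_entry g n \<eta> u (swap_half n i) k (swap_half n j) l =
    half_weight n (- u) i * half_weight n u j * R_entry g n \<eta> u i (swap_half n k) j (swap_half n l)"
proof -
  let ?w = "half_weight n (- u) i * half_weight n u j"
  have rel: "swap_half n i = swap_half n j \<longleftrightarrow> i = j" "swap_half n k = swap_half n l \<longleftrightarrow> k = l"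
    "swap_half n i = k \<longleftrightarrow> i = swap_half n k" "swap_half n i = l \<longleftrightarrow> i = swap_half n l"
    "k = swap_half n j \<longleftrightarrow> swap_half n k = j"
    using lt by (auto simp: swap_half_inj swap_half_eq_iff)
  have conj: "Suc (swap_half n i + k) = 2 * n \<longleftrightarrow> Suc (i + swap_half n k) = 2 * n"
    "Suc (swap_half n j + l) = 2 * n \<longleftrightarrow> Suc (j + swap_half n l) = 2 * n"
    "Suc (swap_half n i + swap_half n j) = 2 * n \<longleftrightarrow> Suc (i + j) = 2 * n"
    using lt by (simp_all add: Suc_swap_half_add_eq_iff)
  show ?thesis
    unfolding R_entry_alt rel conj a_coeff_swap_half[OF lt(1,3)] distrib_left
  proof (intro arg_cong2[of _ _ _ _ "(+)"])
    show "(if i = swap_half n l \<and> swap_half n k = j \<and> i \<noteq> j \<and> Suc (i + j) \<noteq> 2 * n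
         then if swap_half n i < swap_half n j then e_coeff g n \<eta> u else ebar_coeff g n \<eta> u else 0) =
      ?w * (if i = swap_half n l \<and> swap_half n k = j \<and> i \<noteq> j \<and> Suc (i + j) \<noteq> 2 * n
         then if i < j then e_coeff g n \<eta> u else ebar_coeff g n \<eta> u else 0)" (is "(if ?P then _ else _) = _")
    proof (cases ?P)
      case True
      then have ne: "i \<noteq> j" by simp
      show ?thesis unfolding exchange_coeff_swap_half[OF lt(1,3) ne] using True by simp
    qed (simp only: if_False mult_zero_right)
  qed auto
qed

text \<open>At a nonzero entry the column pair is a rearrangement of the row pair, or both pairs
  consist of conjugate indices. Conjugate indices lie in opposite halves, so their weights multiply
  to 1.\<close>

lemma half_weight_conserved:
  assumes "R_entry g n \<eta> u i k j l \<noteq> 0"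
  shows "half_weight n v i * half_weight n v k = half_weight n v j * half_weight n v l"
proof -
  have 1: "half_weight n v a * half_weight n v b = 1" if "Suc (a + b) = 2 * n" for a b
    using that by (auto simp: half_weight_def exp_minus)
  consider "i = j" "k = l" | "i = l" "k = j" | "Suc (i + k) = 2 * n" "Suc (j + l) = 2 * n"
    using assms by (auto simp: R_entry_alt split: if_splits)
  then show ?thesis by cases (simp_all add: 1)
qed

text \<open>Charge conservation trades the weights of the first tensor factor for those of the
  second. Where the entry vanishes there is no conservation law, but both sides are 0.\<close>

lemma R_entry_swap_half':
  assumes lt: "i < 2 * n" "k < 2 * n" "j < 2 * n" "l < 2 * n"
  shows "R_entry g n \<eta> u (swap_half n i) k (swap_half n j) l =
    half_weight n (- u) k * half_weight n u l * R_entry g n \<eta> u i (swap_half n k) j (swap_half n l)"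
proof (cases "R_entry g n \<eta> u i (swap_half n k) j (swap_half n l) = 0")
  case True
  then show ?thesis by (simp add: R_entry_swap_half[OF lt])
next
  case False
  let ?w = "half_weight n u" and ?v = "half_weight n (- u)"
  have cons: "?w i * ?v k = ?w j * ?v l"
    using half_weight_conserved[OF False, of u] lt by (simp add: half_weight_swap_half)
  \<comment> \<open>Products \<open>?v a * ?w a\<close> equal 1; inserting them solves the
    conservation law for \<open>?v k * ?w l\<close> without division.\<close>
  have "(?v i * ?w i) * (?v k * ?w l) = (?w i * ?v k) * (?v i * ?w l)"
    by (simp only: ac_simps)
  also have "\<dots> = (?v l * ?w l) * (?v i * ?w j)"
    unfolding cons by (simp only: ac_simps)
  finally have "?v k * ?w l = ?v i * ?w j" by simp
  then show ?thesis by (simp add: R_entry_swap_half[OF lt])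
qed


section \<open>Conjugating R in one tensor factor\<close>

lemma R_mat_block_index:
  assumes "i < 2 * n" "k < 2 * n" "j < 2 * n" "l < 2 * n"
  shows "R_mat g n \<eta> u $$ (i * (2 * n) + k, j * (2 * n) + l) = R_entry g n \<eta> u i k j l"
  unfolding R_mat_index[OF block_index_less[OF assms(1,2)] block_index_less[OF assms(3,4)]]
    block_index_div_mod[OF assms(2)] block_index_div_mod[OF assms(4)] ..

text \<open>The right weight is read at the shifted column digit, which flips the sign of its
  argument and gives \<open>half_weight n (- v)\<close>.\<close>

lemma on_first_W_mat_index:
  assumes X: "X \<in> carrier_mat (2 * n * (2 * n)) (2 * n * (2 * n))"
    and lt: "x < 2 * n * (2 * n)" "y < 2 * n * (2 * n)"
  shows "(on_first n (W_mat n v) * X * on_first n (W_mat n v)) $$ (x, y) =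
    half_weight n v (x div (2 * n)) *
      X $$ (swap_half n (x div (2 * n)) * (2 * n) + x mod (2 * n),
            swap_half n (y div (2 * n)) * (2 * n) + y mod (2 * n)) *
    half_weight n (- v) (y div (2 * n))"
proof -
  have eq: "on_first n (W_mat n v) = mono_mat (2 * n * (2 * n))
      (\<lambda>x. swap_half n (x div (2 * n)) * (2 * n) + x mod (2 * n)) (\<lambda>x. half_weight n v (x div (2 * n)))"
    unfolding on_first_def W_mat_eq by (rule kron_mono_mat_one) simp
  show ?thesis
    unfolding eq
    by (subst mono_mat_mult_index[OF X _ _ lt])
      (simp_all only: div_mod_less block_index_less block_index_div_mod swap_half_less swap_half_swap_half div_mult_mod_eq
         half_weight_swap_half lt)
qed

lemma on_second_W_mat_index:
  assumes X: "X \<in> carrier_mat (2 * n * (2 * n)) (2 * n * (2 * n))"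
    and lt: "x < 2 * n * (2 * n)" "y < 2 * n * (2 * n)"
  shows "(on_second n (W_mat n v) * X * on_second n (W_mat n v)) $$ (x, y) =
    half_weight n v (x mod (2 * n)) *
      X $$ (x div (2 * n) * (2 * n) + swap_half n (x mod (2 * n)),
            y div (2 * n) * (2 * n) + swap_half n (y mod (2 * n))) *
    half_weight n (- v) (y mod (2 * n))"
proof -
  have eq: "on_second n (W_mat n v) = mono_mat (2 * n * (2 * n))
      (\<lambda>x. x div (2 * n) * (2 * n) + swap_half n (x mod (2 * n))) (\<lambda>x. half_weight n v (x mod (2 * n)))"
    unfolding on_second_def W_mat_eq by (rule kron_one_mono_mat) simp
  show ?thesis
    unfolding eq
    by (subst mono_mat_mult_index[OF X _ _ lt])
      (simp_all only: div_mod_less block_index_less block_index_div_mod swap_half_less swap_half_swap_half div_mult_mod_eq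
         half_weight_swap_half lt)
qed


lemma on_first_U_mat_R_mat:
  "on_first n (U_mat n) * R_mat g n \<eta> u * on_first n (U_mat n)
    = on_second n (transpose_mat (W_mat n u)) * R_mat g n \<eta> u * on_second n (transpose_mat (W_mat n u))"
  (is "?L = ?R")
proof (rule eq_matI)
  have dims: "dim_row ?L = 2 * n * (2 * n)" "dim_row ?R = 2 * n * (2 * n)"
    "dim_col ?L = 2 * n * (2 * n)" "dim_col ?R = 2 * n * (2 * n)"
    by (simp_all add: on_first_def on_second_def kron_def U_mat_def W_mat_def)
  show "dim_row ?L = dim_row ?R" "dim_col ?L = dim_col ?R" by (simp_all only: dims)
  fix x y assume "x < dim_row ?R" "y < dim_col ?R"
  then have lt: "x < 2 * n * (2 * n)" "y < 2 * n * (2 * n)" by (simp_all only: dims)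
  note dm = div_mod_less[OF lt(1)] div_mod_less[OF lt(2)]
  have one: "half_weight n 0 i = 1" for i by (simp add: half_weight_def)
  show "?L $$ (x, y) = ?R $$ (x, y)"
    unfolding W_mat_transpose U_mat_eq on_first_W_mat_index[OF R_mat_carrier lt]
      on_second_W_mat_index[OF R_mat_carrier lt]
    by (simp add: R_mat_block_index dm one R_entry_swap_half' del: mult_Suc_right)
qed

lemma on_second_U_mat_R_mat:
  "on_second n (U_mat n) * R_mat g n \<eta> u * on_second n (U_mat n)
    = on_first n (W_mat n u) * R_mat g n \<eta> u * on_first n (W_mat n u)"
  (is "?L = ?R")
proof (rule eq_matI)
  have dims: "dim_row ?L = 2 * n * (2 * n)" "dim_row ?R = 2 * n * (2 * n)"
    "dim_col ?L = 2 * n * (2 * n)" "dim_col ?R = 2 * n * (2 * n)"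
    by (simp_all add: on_first_def on_second_def kron_def U_mat_def W_mat_def)
  show "dim_row ?L = dim_row ?R" "dim_col ?L = dim_col ?R" by (simp_all only: dims)
  fix x y assume "x < dim_row ?R" "y < dim_col ?R"
  then have lt: "x < 2 * n * (2 * n)" "y < 2 * n * (2 * n)" by (simp_all only: dims)
  note dm = div_mod_less[OF lt(1)] div_mod_less[OF lt(2)]
  have one: "half_weight n 0 i = 1" for i by (simp add: half_weight_def)
  \<comment> \<open>Here W multiplies the entry with shifted first digits, so its weights undo those
    produced by \<open>R_entry_swap_half\<close>. In the other identity the produced weights are
    already those of the transposed W.\<close>
  have cancel: "half_weight n u i * (half_weight n (- u) i * half_weight n u j * X) * half_weight n (- u) j = X"
    for i j X
  proof -
    have "half_weight n u i * (half_weight n (- u) i * half_weight n u j * X) * half_weight n (- u) j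
        = (half_weight n (- u) i * half_weight n u i) * (half_weight n (- u) j * half_weight n u j) * X"
      by (simp only: ac_simps)
    then show ?thesis by simp
  qed
  show "?L $$ (x, y) = ?R $$ (x, y)"
    unfolding U_mat_eq on_first_W_mat_index[OF R_mat_carrier lt]
      on_second_W_mat_index[OF R_mat_carrier lt]
    by (simp add: R_mat_block_index dm one R_entry_swap_half cancel del: mult_Suc_right)
qed

section \<open>The K-matrices\<close>

definition KR_diag :: "affine_type \<Rightarrow> nat \<Rightarrow> complex \<Rightarrow> complex \<Rightarrow> complex \<Rightarrow> nat \<Rightarrow> nat \<Rightarrow> complex" where
  "KR_diag g n \<eta> \<gamma>0 u p i =
     (if i < p then exp (- u)
      else if i < 2 * n - p then
        (gam g n \<eta> \<gamma>0 p * exp u + 1) / (gam g n \<eta> \<gamma>0 p + exp u)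
      else exp u)"

definition M_diag :: "affine_type \<Rightarrow> nat \<Rightarrow> complex \<Rightarrow> nat \<Rightarrow> complex" where
  "M_diag g n \<eta> i = varsig g * exp (4 * ((2 * of_nat n + 1) / 2 - bar_idx g n (Suc i)) * \<eta>)"

lemma KR_mat_eq:
  "KR_mat g n \<eta> \<gamma>0 u p = Matrix.mat (2 * n) (2 * n) (\<lambda>(i, j). if i = j then KR_diag g n \<eta> \<gamma>0 u p i else 0)"
  by (rule eq_matI) (auto simp: KR_mat_def KR_diag_def)

lemma M_mat_eq:
  "M_mat g n \<eta> = Matrix.mat (2 * n) (2 * n) (\<lambda>(i, j). if i = j then M_diag g n \<eta> i else 0)"
proof (rule eq_matI, goal_cases)
  case (1 i j)
  then have ij: "i < 2 * n" "j < 2 * n" by simp_all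
  let ?f = "\<lambda>\<alpha>. exp (4 * ((2 * of_nat n + 1) / 2 - bar_idx g n \<alpha>) * \<eta>)"
  have "(\<Sum>\<alpha>\<in>{1..2 * n}. (?f \<alpha> \<cdot>\<^sub>m elem_mat (2 * n) \<alpha> \<alpha>) $$ (i, j))
      = (\<Sum>\<alpha>\<in>{1..2 * n}. if \<alpha> = Suc i then (if i = j then ?f (Suc i) else 0) else 0)"
    using ij by (intro sum.cong) (auto simp: elem_mat_def)
  also have "\<dots> = (if i = j then ?f (Suc i) else 0)"
    using ij by (subst sum.delta) auto
  finally show ?case
    \<comment> \<open>The scalar rule is limited to the outer factor \<open>varsig g\<close>, so
      that the summands keep the shape in which the sum was just evaluated.\<close>
    using ij by (simp add: M_mat_def matsum_def M_diag_def del: index_smult_mat(1) add: index_smult_mat(1)[of _ "Matrix.mat _ _ _"])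
qed (simp_all add: M_mat_def matsum_def)

lemma mat_diag_mult:
  "Matrix.mat d d (\<lambda>(i, j). if i = j then f i else 0) * Matrix.mat d d (\<lambda>(i, j). if i = j then h i else (0::complex))
    = Matrix.mat d d (\<lambda>(i, j). if i = j then f i * h i else 0)"
proof (rule eq_matI, goal_cases)
  case (1 i j)
  then have ij: "i < d" "j < d" by simp_all
  have "(\<Sum>k\<in>{0..<d}. (if i = k then f i else 0) * (if k = j then h k else 0))
      = (\<Sum>k\<in>{0..<d}. if k = i then (if i = j then f i * h i else 0) else 0)"
    by (rule sum.cong) auto
  then show ?case using ij by (simp add: scalar_prod_def sum.delta)
qed simp_all

lemma KL_mat_eq:
  "KL_mat g n \<eta> \<gamma>0 u p = Matrix.mat (2 * n) (2 * n)
     (\<lambda>(i, j). if i = j then KR_diag g n \<eta> \<gamma>0 (- u - rho g n \<eta>) p i * M_diag g n \<eta> i else 0)"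
  unfolding KL_mat_def KR_mat_eq M_mat_eq by (rule mat_diag_mult)

text \<open>The right factor is the transpose of W(u), not its inverse, so the two weights square
  instead of cancelling.\<close>

lemma W_mat_diag_index:
  assumes "i < 2 * n" "j < 2 * n"
  shows "(W_mat n u * Matrix.mat (2 * n) (2 * n) (\<lambda>(i, j). if i = j then f i else 0) * W_mat n (- u)) $$ (i, j)
    = (if i = j then (half_weight n u i)\<^sup>2 * f (swap_half n i) else 0)"
proof -
  have "(W_mat n u * Matrix.mat (2 * n) (2 * n) (\<lambda>(i, j). if i = j then f i else 0) * W_mat n (- u)) $$ (i, j)
    = half_weight n u i * (if swap_half n i = swap_half n j then f (swap_half n i) else 0)
      * half_weight n (- u) (swap_half n j)"
    unfolding W_mat_eq using assms by (subst mono_mat_mult_index) simp_all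
  then show ?thesis
    using assms by (simp add: swap_half_inj half_weight_swap_half power2_eq_square)
qed

section \<open>Meromorphy and isolated zeros of denominators\<close>

lemma mero_mat_eq_diagI:
  fixes F G :: "complex \<Rightarrow> complex mat" and f h :: "nat \<Rightarrow> complex \<Rightarrow> complex"
  assumes "\<And>u. F u \<in> carrier_mat d d" "\<And>u. G u \<in> carrier_mat d d"
    and F: "\<And>u i j. i < d \<Longrightarrow> j < d \<Longrightarrow> F u $$ (i, j) = (if i = j then f i u else 0)"
    and G: "\<And>u i j. i < d \<Longrightarrow> j < d \<Longrightarrow> G u $$ (i, j) = (if i = j then h i u else 0)"
    and f: "\<And>i. f i meromorphic_on UNIV" and h: "\<And>i. h i meromorphic_on UNIV"
    and ev: "\<And>i. i < d \<Longrightarrow> \<forall>\<^sub>F u in cosparse UNIV. f i u = h i u"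
  shows "mero_mat_eq d F G"
proof -
  have 1: "(\<lambda>u. F u $$ (i, j)) meromorphic_on UNIV" if ij: "i < d" "j < d" for i j
  proof (cases "i = j")
    case True
    show ?thesis unfolding F[OF ij] if_P[OF True] by (rule f)
  next
    case False
    show ?thesis unfolding F[OF ij] if_not_P[OF False] by (rule meromorphic_on_const)
  qed
  have 2: "(\<lambda>u. G u $$ (i, j)) meromorphic_on UNIV" if ij: "i < d" "j < d" for i j
  proof (cases "i = j")
    case True
    show ?thesis unfolding G[OF ij] if_P[OF True] by (rule h)
  next
    case False
    show ?thesis unfolding G[OF ij] if_not_P[OF False] by (rule meromorphic_on_const)
  qed
  have 3: "\<forall>\<^sub>F u in cosparse UNIV. F u $$ (i, j) = G u $$ (i, j)" if ij: "i < d" "j < d" for i j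
  proof (cases "i = j")
    case True
    show ?thesis unfolding F[OF ij] G[OF ij] if_P[OF True] by (rule ev[OF ij(1)])
  next
    case False
    show ?thesis unfolding F[OF ij] G[OF ij] if_not_P[OF False] by simp
  qed
  show ?thesis unfolding mero_mat_eq_def using assms(1,2) 1 2 3 by blast
qed

text \<open>The exponential takes the values 1 and -1, and a + 1 and a - 1 cannot both vanish. The
  function is therefore not identically zero, and zeros of a nonzero entire function are
  isolated.\<close>

lemma eventually_exp_affine_nonzero:
  fixes a k c :: complex
  assumes "k \<noteq> 0"
  shows "\<forall>\<^sub>F u in cosparse UNIV. a + exp (k * u + c) \<noteq> 0"
proof -
  let ?f = "\<lambda>u. a + exp (k * u + c)"
  have holo: "?f holomorphic_on UNIV" by (intro holomorphic_intros)
  have "?f (- c / k) = a + 1" "?f ((of_real pi * \<i> - c) / k) = a - 1"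
    using assms by simp_all
  moreover have "a + 1 \<noteq> 0 \<or> a - 1 \<noteq> 0" by (auto simp: add_eq_0_iff)
  ultimately obtain \<beta> where "?f \<beta> \<noteq> 0" by metis
  then have "\<forall>\<^sub>F u in at z. ?f u \<noteq> 0" for z
    using non_zero_neighbour_alt[OF holo open_UNIV connected_UNIV UNIV_I UNIV_I] by simp
  then show ?thesis by (simp add: eventually_cosparse_open_eq)
qed

lemma meromorphic_on_exp_comp:
  "f analytic_on A \<Longrightarrow> (\<lambda>u. exp (f u :: complex)) meromorphic_on A"
  by (intro analytic_on_imp_meromorphic_on analytic_intros)

text \<open>The inner function \<open>f\<close> covers both arguments that occur, u for K^R and
  -u-\<rho> for K^L.\<close>

lemma KR_diag_meromorphic:
  assumes "f analytic_on UNIV"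
  shows "(\<lambda>u. KR_diag g n \<eta> \<gamma>0 (f u) p i) meromorphic_on UNIV"
proof -
  have "(\<lambda>u. (gam g n \<eta> \<gamma>0 p * exp (f u) + 1) / (gam g n \<eta> \<gamma>0 p + exp (f u))) meromorphic_on UNIV"
    by (intro meromorphic_intros meromorphic_on_exp_comp assms)
  moreover have "(\<lambda>u. exp (f u)) meromorphic_on UNIV" "(\<lambda>u. exp (- f u)) meromorphic_on UNIV"
    by (intro meromorphic_on_exp_comp analytic_intros assms)+
  ultimately show ?thesis
    unfolding KR_diag_def by (cases "i < p"; cases "i < 2 * n - p"; simp)
qed

lemma half_weight_meromorphic:
  assumes "f analytic_on UNIV"
  shows "(\<lambda>u. half_weight n (f u) i) meromorphic_on UNIV"
  unfolding half_weight_def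
  by (cases "i < n") (auto intro!: meromorphic_on_exp_comp analytic_intros assms)

section \<open>Scalar identities for the K-matrices\<close>

lemma gam_eq: "gam g n \<eta> \<gamma>0 p = \<gamma>0 * exp ((4 * of_nat p - 2 * of_nat n) * \<eta>)"
proof -
  \<comment> \<open>Half of \<rho> is -\<kappa>\<eta>, and the type-dependent part of \<kappa>
    cancels the type-dependent part of the exponent. What remains changes sign under p -> n -
    p.\<close>
  have "(4 * of_nat p + 2 * type_sign g) * \<eta> + rho g n \<eta> / 2 = (4 * of_nat p - 2 * of_nat n) * \<eta>"
    by (cases g) (simp_all add: rho_def field_simps)
  then show ?thesis by (simp only: gam_def)
qed

text \<open>The factor \<open>fR\<close> is the middle entry of K^R(u,p), and since \<gamma>0
  squares to 1 the middle entry of K^R(u,n-p) is its reciprocal. The shift carries the middle block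
  to the outer blocks. The outer blocks land in the middle, where the squared weights turn their
  entries into 1.\<close>

lemma KR_diag_swap_half:
  assumes \<gamma>0: "\<gamma>0 \<in> {1, - 1}" and p: "p \<le> n" and i: "i < 2 * n"
    and den: "gam g n \<eta> \<gamma>0 p + exp u \<noteq> 0" "gam g n \<eta> \<gamma>0 (n - p) + exp u \<noteq> 0"
  shows "(half_weight n u i)\<^sup>2 * KR_diag g n \<eta> \<gamma>0 u p (swap_half n i)
    = fR n \<eta> \<gamma>0 u p * KR_diag g n \<eta> \<gamma>0 u (n - p) i"
proof -
  define q where "q = exp ((4 * of_nat p - 2 * of_nat n) * \<eta>)"
  define x where "x = exp u"
  have nz: "q \<noteq> 0" "x \<noteq> 0" by (simp_all add: q_def x_def)
  have g2: "\<gamma>0 * \<gamma>0 = 1" using \<gamma>0 by auto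
  have gp: "gam g n \<eta> \<gamma>0 p = \<gamma>0 * q" by (simp add: gam_eq q_def)
  have iq: "exp ((2 * of_nat n - 4 * of_nat p) * \<eta>) = inverse q"
    by (simp add: q_def algebra_simps flip: exp_minus)
  have gnp: "gam g n \<eta> \<gamma>0 (n - p) = \<gamma>0 * inverse q"
    using p by (simp add: gam_eq of_nat_diff algebra_simps flip: iq)
  have d1: "\<gamma>0 * q + x \<noteq> 0" using den(1) by (simp add: gp x_def)
  have d2: "\<gamma>0 + x * q \<noteq> 0"
    using den(2) nz by (simp add: gnp x_def field_simps)
  have fR: "fR n \<eta> \<gamma>0 u p = (\<gamma>0 * q * x + 1) / (\<gamma>0 * q + x)"
  proof -
    have "fR n \<eta> \<gamma>0 u p = (q * (\<gamma>0 * x + inverse q)) / (q * (\<gamma>0 + x * inverse q))"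
      unfolding fR_def exp_add iq x_def[symmetric] using nz by simp
    also have "q * (\<gamma>0 * x + inverse q) = \<gamma>0 * q * x + 1"
      using nz by (simp add: distrib_left)
    also have "q * (\<gamma>0 + x * inverse q) = \<gamma>0 * q + x"
      using nz by (simp add: distrib_left)
    finally show ?thesis .
  qed
  \<comment> \<open>Multiplied by \<gamma>0, this numerator becomes the denominator
    \<open>\<gamma>0 + x * q\<close> belonging to n - p, so the second hypothesis in
    \<open>den\<close> rules out its vanishing.\<close>
  have d3: "\<gamma>0 * q * x + 1 \<noteq> 0"
  proof
    assume "\<gamma>0 * q * x + 1 = 0"
    then have "\<gamma>0 * (\<gamma>0 * q * x + 1) = 0" by simp
    then have "(\<gamma>0 * \<gamma>0) * (q * x) + \<gamma>0 = 0" by (simp add: algebra_simps)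
    then show False using d2 by (simp add: g2 algebra_simps)
  qed
  have r2: "(\<gamma>0 * inverse q * x + 1) / (\<gamma>0 * inverse q + x) = (\<gamma>0 * q + x) / (\<gamma>0 * q * x + 1)"
  proof -
    have "(\<gamma>0 * inverse q * x + 1) / (\<gamma>0 * inverse q + x)
        = (q * (\<gamma>0 * inverse q * x + 1)) / (q * (\<gamma>0 * inverse q + x))"
      using nz by simp
    also have "q * (\<gamma>0 * inverse q * x + 1) = \<gamma>0 * x + q"
      using nz by (simp add: distrib_left)
    also have "q * (\<gamma>0 * inverse q + x) = \<gamma>0 + x * q"
      using nz by (simp add: distrib_left mult.commute[of q x])
    also have "(\<gamma>0 * x + q) / (\<gamma>0 + x * q) = (\<gamma>0 * (\<gamma>0 * x + q)) / (\<gamma>0 * (\<gamma>0 + x * q))"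
      using \<gamma>0 by auto
    also have "\<gamma>0 * (\<gamma>0 * x + q) = \<gamma>0 * \<gamma>0 * x + \<gamma>0 * q"
      by (simp add: algebra_simps)
    also have "\<dots> = \<gamma>0 * q + x"
      by (simp only: g2 mult_1_left add.commute)
    also have "\<gamma>0 * (\<gamma>0 + x * q) = \<gamma>0 * q * x + \<gamma>0 * \<gamma>0"
      by (simp add: algebra_simps)
    also have "\<dots> = \<gamma>0 * q * x + 1"
      by (simp only: g2)
    finally show ?thesis .
  qed
  have one: "(\<gamma>0 * q * x + 1) / (\<gamma>0 * q + x) * ((\<gamma>0 * q + x) / (\<gamma>0 * q * x + 1)) = 1"
    using d1 d3 by simp
  have w: "(half_weight n u i)\<^sup>2 = (if i < n then inverse x else x)"
    by (simp add: half_weight_def x_def power2_eq_square flip: exp_add exp_minus)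
  show ?thesis
    using i p one nz
    unfolding w fR KR_diag_def gp gnp r2 exp_minus x_def[symmetric]
    by (auto simp: swap_half_def)
qed

text \<open>Substituting -u-\<rho> and multiplying numerator and denominator by
  \<open>\<gamma>0 * x * q\<close> turns one fraction into the other, as \<gamma>0 squares to 1. The
  multiplier never vanishes, so the equality holds at every u, poles included.\<close>

lemma fL_eq_fR:
  "fL g n \<eta> \<gamma>0 u p = fR n \<eta> \<gamma>0 (- u - rho g n \<eta>) p" if "\<gamma>0 \<in> {1, - 1}"
proof -
  define q where "q = exp ((4 * of_nat p - 2 * of_nat n) * \<eta>)"
  define r where "r = exp ((4 * of_nat n + 4 * type_sign g) * \<eta>)"
  define x where "x = exp u"
  have nz: "q \<noteq> 0" "r \<noteq> 0" "x \<noteq> 0" by (simp_all add: q_def r_def x_def)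
  have iq: "exp ((2 * of_nat n - 4 * of_nat p) * \<eta>) = inverse q"
    by (simp add: q_def algebra_simps flip: exp_minus)
  have qr: "exp ((4 * of_nat p + 2 * of_nat n + 4 * type_sign g) * \<eta>) = q * r"
    by (simp add: q_def r_def algebra_simps flip: exp_add)
  have rx: "exp (- u - rho g n \<eta>) = r / x"
  proof -
    have "- rho g n \<eta> = (4 * of_nat n + 4 * type_sign g) * \<eta>"
      by (cases g) (simp_all add: rho_def algebra_simps)
    then have "- u - rho g n \<eta> = (4 * of_nat n + 4 * type_sign g) * \<eta> - u" by simp
    then show ?thesis by (simp only: exp_diff r_def x_def)
  qed
  have "fR n \<eta> \<gamma>0 (- u - rho g n \<eta>) p = (\<gamma>0 * (r / x) + inverse q) / (\<gamma>0 + r / x * inverse q)"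
    unfolding fR_def exp_add iq rx ..
  also have "\<dots> = (\<gamma>0 * x * q * (\<gamma>0 * (r / x) + inverse q)) / (\<gamma>0 * x * q * (\<gamma>0 + r / x * inverse q))"
    using nz that by auto
  also have "\<gamma>0 * x * q * (\<gamma>0 * (r / x) + inverse q) = \<gamma>0 * x + q * r"
    using nz that by (auto simp: field_simps)
  also have "\<gamma>0 * x * q * (\<gamma>0 + r / x * inverse q) = \<gamma>0 * r + x * q"
    using nz that by (auto simp: field_simps)
  also have "(\<gamma>0 * x + q * r) / (\<gamma>0 * r + x * q) = fL g n \<eta> \<gamma>0 u p"
    unfolding fL_def exp_add qr by (simp add: q_def r_def x_def)
  finally show ?thesis ..
qed

text \<open>Moving the barred index by \<kappa>/2 up or down multiplies the entry of M by
  exp(\<rho>) or exp(-\<rho>). This replaces the squared weight at -u by the one at -u-\<rho>, the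
  argument at which K^L evaluates K^R.\<close>

lemma M_diag_swap_half:
  assumes "i < 2 * n"
  shows "(half_weight n (- u) i)\<^sup>2 * M_diag g n \<eta> (swap_half n i)
    = (half_weight n (- u - rho g n \<eta>) i)\<^sup>2 * M_diag g n \<eta> i"
proof -
  have w: "(half_weight n v i)\<^sup>2 = exp (if i < n then - v else v)" for v
    by (simp add: half_weight_def power2_eq_square flip: exp_add)
  have "exp (if i < n then - (- u) else - u) * exp (4 * ((2 * of_nat n + 1) / 2 - bar_idx g n (Suc (swap_half n i))) * \<eta>)
     = exp (if i < n then - (- u - rho g n \<eta>) else - u - rho g n \<eta>) * exp (4 * ((2 * of_nat n + 1) / 2 - bar_idx g n (Suc i)) * \<eta>)"
    unfolding exp_add[symmetric] bar_idx_swap_half[OF assms] rho_def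
    by (rule arg_cong[of _ _ exp]) (simp add: field_simps)
  then show ?thesis
    unfolding w M_diag_def by (simp only: mult.left_commute[of _ "varsig g"])
qed

theorem lemma5:
  fixes g :: affine_type and n :: nat and \<eta> \<gamma>0 :: complex
  assumes "n \<ge> 1" and "\<gamma>0 \<in> {1, -1}"
  shows "(\<forall>u.
            on_first n (U_mat n) * R_mat g n \<eta> u * on_first n (U_mat n)
              = on_second n (transpose_mat (W_mat n u)) * R_mat g n \<eta> u
                  * on_second n (transpose_mat (W_mat n u)) \<and>
            on_second n (U_mat n) * R_mat g n \<eta> u * on_second n (U_mat n)
              = on_first n (W_mat n u) * R_mat g n \<eta> u * on_first n (W_mat n u)) \<and>
         (\<forall>p\<in>{0..n}.
            mero_mat_eq (2 * n)
              (\<lambda>u. W_mat n u * KR_mat g n \<eta> \<gamma>0 u p * transpose_mat (W_mat n u))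
              (\<lambda>u. fR n \<eta> \<gamma>0 u p \<cdot>\<^sub>m KR_mat g n \<eta> \<gamma>0 u (n - p)) \<and>
            mero_mat_eq (2 * n)
              (\<lambda>u. transpose_mat (W_mat n u) * KL_mat g n \<eta> \<gamma>0 u p * W_mat n u)
              (\<lambda>u. fL g n \<eta> \<gamma>0 u p \<cdot>\<^sub>m KL_mat g n \<eta> \<gamma>0 u (n - p)))"
proof (intro conjI allI ballI)
  fix u
  show "on_first n (U_mat n) * R_mat g n \<eta> u * on_first n (U_mat n)
      = on_second n (transpose_mat (W_mat n u)) * R_mat g n \<eta> u
          * on_second n (transpose_mat (W_mat n u))"
    by (rule on_first_U_mat_R_mat)
  show "on_second n (U_mat n) * R_mat g n \<eta> u * on_second n (U_mat n)
      = on_first n (W_mat n u) * R_mat g n \<eta> u * on_first n (W_mat n u)"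
    by (rule on_second_U_mat_R_mat)
next
  fix p assume "p \<in> {0..n}"
  then have p: "p \<le> n" by simp
  let ?v = "\<lambda>u. - u - rho g n \<eta>"
  have W: "W_mat n u \<in> carrier_mat (2 * n) (2 * n)" for u
    by (simp add: W_mat_eq)
  have fR: "(\<lambda>u. fR n \<eta> \<gamma>0 (f u) p) meromorphic_on UNIV" if "f analytic_on UNIV" for f
    unfolding fR_def by (intro meromorphic_intros meromorphic_on_exp_comp analytic_intros that)
  show "mero_mat_eq (2 * n)
      (\<lambda>u. W_mat n u * KR_mat g n \<eta> \<gamma>0 u p * transpose_mat (W_mat n u))
      (\<lambda>u. fR n \<eta> \<gamma>0 u p \<cdot>\<^sub>m KR_mat g n \<eta> \<gamma>0 u (n - p))"
  proof (rule mero_mat_eq_diagI)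
    fix u i j assume ij: "i < 2 * n" "j < 2 * n"
    show "(W_mat n u * KR_mat g n \<eta> \<gamma>0 u p * transpose_mat (W_mat n u)) $$ (i, j)
        = (if i = j then (half_weight n u i)\<^sup>2 * KR_diag g n \<eta> \<gamma>0 u p (swap_half n i) else 0)"
      unfolding W_mat_transpose KR_mat_eq by (rule W_mat_diag_index[OF ij])
    show "(fR n \<eta> \<gamma>0 u p \<cdot>\<^sub>m KR_mat g n \<eta> \<gamma>0 u (n - p)) $$ (i, j)
        = (if i = j then fR n \<eta> \<gamma>0 u p * KR_diag g n \<eta> \<gamma>0 u (n - p) i else 0)"
      using ij by (simp add: KR_mat_eq)
  next
    fix i assume i: "i < 2 * n"
    \<comment> \<open>The scalar identity needs the denominators for p and for n - p to be nonzero,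
      so it is claimed off the two zero sets.\<close>
    have "\<forall>\<^sub>F u in cosparse UNIV. gam g n \<eta> \<gamma>0 k + exp u \<noteq> 0" for k
      using eventually_exp_affine_nonzero[of 1 "gam g n \<eta> \<gamma>0 k" 0] by simp
    from this[of p] this[of "n - p"]
    show "\<forall>\<^sub>F u in cosparse UNIV. (half_weight n u i)\<^sup>2 * KR_diag g n \<eta> \<gamma>0 u p (swap_half n i)
        = fR n \<eta> \<gamma>0 u p * KR_diag g n \<eta> \<gamma>0 u (n - p) i"
      by eventually_elim (rule KR_diag_swap_half[OF assms(2) p i])
  next
    fix i
    show "(\<lambda>u. (half_weight n u i)\<^sup>2 * KR_diag g n \<eta> \<gamma>0 u p (swap_half n i)) meromorphic_on UNIV"
      by (intro meromorphic_intros half_weight_meromorphic KR_diag_meromorphic analytic_intros)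
    show "(\<lambda>u. fR n \<eta> \<gamma>0 u p * KR_diag g n \<eta> \<gamma>0 u (n - p) i) meromorphic_on UNIV"
      by (intro meromorphic_intros fR KR_diag_meromorphic analytic_intros)
  qed (auto simp: KR_mat_eq W_mat_transpose carrier_matD[OF W] intro!: carrier_matI)
  show "mero_mat_eq (2 * n)
      (\<lambda>u. transpose_mat (W_mat n u) * KL_mat g n \<eta> \<gamma>0 u p * W_mat n u)
      (\<lambda>u. fL g n \<eta> \<gamma>0 u p \<cdot>\<^sub>m KL_mat g n \<eta> \<gamma>0 u (n - p))"
  proof (rule mero_mat_eq_diagI)
    fix u i j assume ij: "i < 2 * n" "j < 2 * n"
    show "(transpose_mat (W_mat n u) * KL_mat g n \<eta> \<gamma>0 u p * W_mat n u) $$ (i, j)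
        = (if i = j then (half_weight n (- u) i)\<^sup>2 *
             (KR_diag g n \<eta> \<gamma>0 (?v u) p (swap_half n i) * M_diag g n \<eta> (swap_half n i)) else 0)"
      unfolding W_mat_transpose KL_mat_eq using W_mat_diag_index[OF ij, of "- u"] by simp
    show "(fL g n \<eta> \<gamma>0 u p \<cdot>\<^sub>m KL_mat g n \<eta> \<gamma>0 u (n - p)) $$ (i, j)
        = (if i = j then fR n \<eta> \<gamma>0 (?v u) p * (KR_diag g n \<eta> \<gamma>0 (?v u) (n - p) i * M_diag g n \<eta> i) else 0)"
      using ij by (simp add: KL_mat_eq fL_eq_fR[OF assms(2)])
  next
    fix i assume i: "i < 2 * n"
    have "\<forall>\<^sub>F u in cosparse UNIV. gam g n \<eta> \<gamma>0 k + exp (?v u) \<noteq> 0" for k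
      using eventually_exp_affine_nonzero[of "- 1" "gam g n \<eta> \<gamma>0 k" "- rho g n \<eta>"] by simp
    from this[of p] this[of "n - p"]
    show "\<forall>\<^sub>F u in cosparse UNIV. (half_weight n (- u) i)\<^sup>2 *
          (KR_diag g n \<eta> \<gamma>0 (?v u) p (swap_half n i) * M_diag g n \<eta> (swap_half n i))
        = fR n \<eta> \<gamma>0 (?v u) p * (KR_diag g n \<eta> \<gamma>0 (?v u) (n - p) i * M_diag g n \<eta> i)"
    proof eventually_elim
      case (elim u)
      \<comment> \<open>Pairing the weight with M first shifts its argument to \<open>?v u\<close>;
        the identity for K^R then applies there, with M as a spectator.\<close>
      have "(half_weight n (- u) i)\<^sup>2 *
          (KR_diag g n \<eta> \<gamma>0 (?v u) p (swap_half n i) * M_diag g n \<eta> (swap_half n i))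
          = ((half_weight n (- u) i)\<^sup>2 * M_diag g n \<eta> (swap_half n i)) * KR_diag g n \<eta> \<gamma>0 (?v u) p (swap_half n i)"
        by (simp only: ac_simps)
      also have "\<dots> = ((half_weight n (?v u) i)\<^sup>2 * KR_diag g n \<eta> \<gamma>0 (?v u) p (swap_half n i)) * M_diag g n \<eta> i"
        unfolding M_diag_swap_half[OF i] by (simp only: ac_simps)
      also have "\<dots> = (fR n \<eta> \<gamma>0 (?v u) p * KR_diag g n \<eta> \<gamma>0 (?v u) (n - p) i) * M_diag g n \<eta> i"
        unfolding KR_diag_swap_half[OF assms(2) p i elim] ..
      finally show ?case by (simp only: mult.assoc)
    qed
  next
    fix i
    show "(\<lambda>u. (half_weight n (- u) i)\<^sup>2 *
        (KR_diag g n \<eta> \<gamma>0 (?v u) p (swap_half n i) * M_diag g n \<eta> (swap_half n i))) meromorphic_on UNIV"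
      by (intro meromorphic_intros half_weight_meromorphic KR_diag_meromorphic analytic_intros)
    show "(\<lambda>u. fR n \<eta> \<gamma>0 (?v u) p * (KR_diag g n \<eta> \<gamma>0 (?v u) (n - p) i * M_diag g n \<eta> i)) meromorphic_on UNIV"
      by (intro meromorphic_intros fR KR_diag_meromorphic analytic_intros)
  qed (auto simp: KL_mat_eq W_mat_transpose carrier_matD[OF W] intro!: carrier_matI)
qed

end
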